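(* Let $k$ be a commutative ring and let $\mathcal{M}=(C,D,[\,,]_C)$ be a regular torsion algebra over $k$, with algebra of $\mathcal{M}$-functions $A\subseteq \mathrm{End}_k(C)$, torsion $T$, associator $\alpha$, and action $X\cdot\phi=[D_X,\phi]$ of $X\in C$ on $\phi\in A$. Then, for all $X,Y\in C$ and every $\mathcal{M}$-function $\phi\in \mathrm{End}_k(C)$: (1) $X\cdot\phi$ is an $\mathcal{M}$-function. (2) $X$ acts as a derivation on $\mathcal{M}$-functions, i.e. $X\cdot(\phi\circ\psi)=(X\cdot\phi)\circ\psi+\phi\circ(X\cdot\psi)$ for all $\phi,\psi\in A$. (3) The associator $\alpha$ of $D$ is $A$-linear in the first two variables. (4) $[X,\phi Y]_C=\phi[X,Y]_C+(X\cdot\phi)Y$. (5) $D$ is a connection on $\mathcal{M}$: $D_X(\phi Y)=(X\cdot\phi)Y+\phi D_XY$. (6) The torsion $T$ is $A$-bilinear.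
   Context: A torsion algebra $\mathcal{M}=(C,D,[\,,]_C)$ over $k$ is a (possibly non-associative, not necessarily unital) $k$-algebra $C$ with $k$-bilinear multiplication written $D_XY$ (the product of $X$ and $Y$; $D_X\in\mathrm{End}_k(C)$ is $Y\mapsto D_XY$), together with a $k$-Lie bracket $[\,,]_C$ on $C$; no compatibility is required. Elements of $C$ are called $\mathcal{M}$-vector fields. The torsion is $T(X,Y)=D_XY-D_YX-[X,Y]_C$. The associator is $\alpha(X,Y,Z)=D_{D_XY}Z-D_X(D_YZ)$. The set of $\mathcal{M}$-functions is $A=\{\phi\in\mathrm{End}_k(C) : D_{\phi(X)}Y=\phi(D_XY)\ \text{for all } X,Y\in C\}$. It is closed under composition, is an associative algebra under composition, and $C$ is a left $A$-module via $\phi X=\phi(X)$. A vector field $X\in C$ acts on $\phi\in A$ by $X\cdot\phi=[D_X,\phi]=D_X\circ\phi-\phi\circ D_X\in\mathrm{End}_k(C)$. $A$-bilinearity of $T$ means additivity and $T(\phi X,Y)=\phi T(X,Y)=T(X,\phi Y)$ for all $\phi\in A$, $X,Y\in C$. $A$-linearity of $\alpha$ in the first two variables means $\alpha(\phi X,Y,Z)=\phi\,\alpha(X,Y,Z)=\alpha(X,\phi Y,Z)$ for all $\phi\in A$, $X,Y,Z\in C$. A torsion algebra is called regular if its torsion $T$ is $A$-bilinear and its associator $\alpha$ is $A$-linear in each of the first two variables. *)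

theory Defs
  imports "HOL-Algebra.Module" "HOL-Library.FuncSet"
begin

text \<open>
  Only the ring and module axioms of the HOL-Algebra locale \<open>module\<close> are used for \<open>C\<close>; the
  fields \<open>mult\<close> and \<open>one\<close> that its record type carries are left unconstrained.
  Endomorphisms are extensional functions on \<open>carrier C\<close>, so that HOL equality of two of them is
  equality in the endomorphism ring.
\<close>

definition module_End :: "('k, 'm) ring_scheme \<Rightarrow> ('k, 'c, 'n) module_scheme \<Rightarrow> ('c \<Rightarrow> 'c) set"
  where "module_End k C =
    {f \<in> carrier C \<rightarrow>\<^sub>E carrier C.
      (\<forall>X\<in>carrier C. \<forall>Y\<in>carrier C. f (X \<oplus>\<^bsub>C\<^esub> Y) = f X \<oplus>\<^bsub>C\<^esub> f Y) \<and>
      (\<forall>a\<in>carrier k. \<forall>X\<in>carrier C. f (a \<odot>\<^bsub>C\<^esub> X) = a \<odot>\<^bsub>C\<^esub> f X)}"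

definition End_plus :: "('k, 'c, 'n) module_scheme \<Rightarrow> ('c \<Rightarrow> 'c) \<Rightarrow> ('c \<Rightarrow> 'c) \<Rightarrow> 'c \<Rightarrow> 'c"
  where "End_plus C f g = (\<lambda>Z\<in>carrier C. f Z \<oplus>\<^bsub>C\<^esub> g Z)"

definition End_minus :: "('k, 'c, 'n) module_scheme \<Rightarrow> ('c \<Rightarrow> 'c) \<Rightarrow> ('c \<Rightarrow> 'c) \<Rightarrow> 'c \<Rightarrow> 'c"
  where "End_minus C f g = (\<lambda>Z\<in>carrier C. f Z \<ominus>\<^bsub>C\<^esub> g Z)"

definition End_comp :: "('k, 'c, 'n) module_scheme \<Rightarrow> ('c \<Rightarrow> 'c) \<Rightarrow> ('c \<Rightarrow> 'c) \<Rightarrow> 'c \<Rightarrow> 'c"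
  where "End_comp C f g = compose (carrier C) f g"

locale lie_bracket = module k C
  for k :: "('k, 'm) ring_scheme" and C :: "('k, 'c, 'n) module_scheme" +
  fixes lie :: "'c \<Rightarrow> 'c \<Rightarrow> 'c"
  assumes lie_closed:
      "\<lbrakk>X \<in> carrier C; Y \<in> carrier C\<rbrakk> \<Longrightarrow> lie X Y \<in> carrier C"
    and lie_add_left:
      "\<lbrakk>X \<in> carrier C; Y \<in> carrier C; Z \<in> carrier C\<rbrakk>
        \<Longrightarrow> lie (X \<oplus>\<^bsub>C\<^esub> Y) Z = lie X Z \<oplus>\<^bsub>C\<^esub> lie Y Z"
    and lie_add_right:
      "\<lbrakk>X \<in> carrier C; Y \<in> carrier C; Z \<in> carrier C\<rbrakk>
        \<Longrightarrow> lie X (Y \<oplus>\<^bsub>C\<^esub> Z) = lie X Y \<oplus>\<^bsub>C\<^esub> lie X Z"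
    and lie_smult_left:
      "\<lbrakk>a \<in> carrier k; X \<in> carrier C; Y \<in> carrier C\<rbrakk>
        \<Longrightarrow> lie (a \<odot>\<^bsub>C\<^esub> X) Y = a \<odot>\<^bsub>C\<^esub> lie X Y"
    and lie_smult_right:
      "\<lbrakk>a \<in> carrier k; X \<in> carrier C; Y \<in> carrier C\<rbrakk>
        \<Longrightarrow> lie X (a \<odot>\<^bsub>C\<^esub> Y) = a \<odot>\<^bsub>C\<^esub> lie X Y"
    and lie_alternating:
      "X \<in> carrier C \<Longrightarrow> lie X X = \<zero>\<^bsub>C\<^esub>"
    and lie_jacobi:
      "\<lbrakk>X \<in> carrier C; Y \<in> carrier C; Z \<in> carrier C\<rbrakk>
        \<Longrightarrow> lie X (lie Y Z) \<oplus>\<^bsub>C\<^esub> lie Y (lie Z X) \<oplus>\<^bsub>C\<^esub> lie Z (lie X Y) = \<zero>\<^bsub>C\<^esub>"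

text \<open>
  \<open>D X Y\<close> is the product \<open>D\<^sub>X Y\<close>. Its linearity in \<open>Y\<close> is the condition that \<open>D X\<close> is an
  endomorphism.
\<close>

locale torsion_algebra = lie_bracket k C lie
  for k :: "('k, 'm) ring_scheme" and C :: "('k, 'c, 'n) module_scheme"
    and D :: "'c \<Rightarrow> 'c \<Rightarrow> 'c" and lie :: "'c \<Rightarrow> 'c \<Rightarrow> 'c" +
  assumes D_End:
      "X \<in> carrier C \<Longrightarrow> D X \<in> module_End k C"
    and D_add_left:
      "\<lbrakk>X \<in> carrier C; Y \<in> carrier C; Z \<in> carrier C\<rbrakk>
        \<Longrightarrow> D (X \<oplus>\<^bsub>C\<^esub> Y) Z = D X Z \<oplus>\<^bsub>C\<^esub> D Y Z"
    and D_smult_left: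
      "\<lbrakk>a \<in> carrier k; X \<in> carrier C; Y \<in> carrier C\<rbrakk>
        \<Longrightarrow> D (a \<odot>\<^bsub>C\<^esub> X) Y = a \<odot>\<^bsub>C\<^esub> D X Y"

definition torsion ::
    "('k, 'c, 'n) module_scheme \<Rightarrow> ('c \<Rightarrow> 'c \<Rightarrow> 'c) \<Rightarrow> ('c \<Rightarrow> 'c \<Rightarrow> 'c) \<Rightarrow> 'c \<Rightarrow> 'c \<Rightarrow> 'c"
  where "torsion C D lie X Y = D X Y \<ominus>\<^bsub>C\<^esub> D Y X \<ominus>\<^bsub>C\<^esub> lie X Y"

definition associator ::
    "('k, 'c, 'n) module_scheme \<Rightarrow> ('c \<Rightarrow> 'c \<Rightarrow> 'c) \<Rightarrow> 'c \<Rightarrow> 'c \<Rightarrow> 'c \<Rightarrow> 'c"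
  where "associator C D X Y Z = D (D X Y) Z \<ominus>\<^bsub>C\<^esub> D X (D Y Z)"

definition mfunctions ::
    "('k, 'm) ring_scheme \<Rightarrow> ('k, 'c, 'n) module_scheme \<Rightarrow> ('c \<Rightarrow> 'c \<Rightarrow> 'c) \<Rightarrow> ('c \<Rightarrow> 'c) set"
  where "mfunctions k C D =
    {\<phi> \<in> module_End k C. \<forall>X\<in>carrier C. \<forall>Y\<in>carrier C. D (\<phi> X) Y = \<phi> (D X Y)}"

definition act ::
    "('k, 'c, 'n) module_scheme \<Rightarrow> ('c \<Rightarrow> 'c \<Rightarrow> 'c) \<Rightarrow> 'c \<Rightarrow> ('c \<Rightarrow> 'c) \<Rightarrow> 'c \<Rightarrow> 'c"
  where "act C D X \<phi> = End_minus C (End_comp C (D X) \<phi>) (End_comp C \<phi> (D X))"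

text \<open>
  In the next two definitions \<open>A\<close> is a set of endomorphisms of \<open>C\<close>, acting on \<open>C\<close> by application.
\<close>

definition bilinear_over ::
    "('c \<Rightarrow> 'c) set \<Rightarrow> ('k, 'c, 'n) module_scheme \<Rightarrow> ('c \<Rightarrow> 'c \<Rightarrow> 'c) \<Rightarrow> bool"
  where "bilinear_over A C T \<longleftrightarrow>
    (\<forall>X\<in>carrier C. \<forall>Y\<in>carrier C. \<forall>Z\<in>carrier C.
      T (X \<oplus>\<^bsub>C\<^esub> Y) Z = T X Z \<oplus>\<^bsub>C\<^esub> T Y Z \<and> T X (Y \<oplus>\<^bsub>C\<^esub> Z) = T X Y \<oplus>\<^bsub>C\<^esub> T X Z) \<and>
    (\<forall>\<phi>\<in>A. \<forall>X\<in>carrier C. \<forall>Y\<in>carrier C.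
      T (\<phi> X) Y = \<phi> (T X Y) \<and> T X (\<phi> Y) = \<phi> (T X Y))"

text \<open>
  Additivity in the first two variables is not listed below: the associator of a torsion algebra
  is additive in every variable.
\<close>

definition linear_over_first_two ::
    "('c \<Rightarrow> 'c) set \<Rightarrow> ('k, 'c, 'n) module_scheme \<Rightarrow> ('c \<Rightarrow> 'c \<Rightarrow> 'c \<Rightarrow> 'c) \<Rightarrow> bool"
  where "linear_over_first_two A C \<alpha> \<longleftrightarrow>
    (\<forall>\<phi>\<in>A. \<forall>X\<in>carrier C. \<forall>Y\<in>carrier C. \<forall>Z\<in>carrier C.
      \<alpha> (\<phi> X) Y Z = \<phi> (\<alpha> X Y Z) \<and> \<alpha> X (\<phi> Y) Z = \<phi> (\<alpha> X Y Z))"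

locale regular_torsion_algebra = torsion_algebra k C D lie
  for k :: "('k, 'm) ring_scheme" and C :: "('k, 'c, 'n) module_scheme"
    and D :: "'c \<Rightarrow> 'c \<Rightarrow> 'c" and lie :: "'c \<Rightarrow> 'c \<Rightarrow> 'c" +
  assumes torsion_bilinear: "bilinear_over (mfunctions k C D) C (torsion C D lie)"
    and associator_linear: "linear_over_first_two (mfunctions k C D) C (associator C D)"

end

theory Submission
  imports Defs
begin

text \<open>
  Writing out \<open>\<alpha>(X, \<phi>Y, Z) = \<phi> \<alpha>(X, Y, Z)\<close> and moving terms across the equation gives
  \<open>D\<^bsub>(X\<cdot>\<phi>)Y\<^esub> Z = (X\<cdot>\<phi>)(D\<^sub>Y Z)\<close>, so \<open>X\<cdot>\<phi>\<close> is an M-function. In the same way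
  \<open>T(X, \<phi>Y) = \<phi> T(X, Y)\<close> gives the Leibniz rule for the bracket, because \<open>D\<^bsub>\<phi>Y\<^esub> X = \<phi> D\<^sub>Y X\<close>
  cancels. The other claims hold in any torsion algebra or are part of regularity.
\<close>

lemma (in abelian_group) diff_telescope:
  assumes "a \<in> carrier G" "b \<in> carrier G" "c \<in> carrier G"
  shows "(a \<ominus> b) \<oplus> (b \<ominus> c) = a \<ominus> c"
  using assms by (simp add: a_minus_def a_assoc r_neg1)

text \<open>Moves a term across an equation between differences: insert \<open>b\<close> between
  \<open>a\<close> and \<open>c\<close>, replace \<open>a \<ominus> b\<close> by
  \<open>c \<ominus> d\<close>, and telescope again.\<close>

lemma (in abelian_group) diff_diff_swap:
  assumes "a \<in> carrier G" "b \<in> carrier G" "c \<in> carrier G" "d \<in> carrier G"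
    and "a \<ominus> b = c \<ominus> d"
  shows "a \<ominus> c = b \<ominus> d"
proof -
  have "a \<ominus> c = (a \<ominus> b) \<oplus> (b \<ominus> c)"
    using assms(1-4) by (simp add: diff_telescope)
  also have "\<dots> = (b \<ominus> c) \<oplus> (c \<ominus> d)"
    using assms by (simp add: a_comm)
  also have "\<dots> = b \<ominus> d"
    using assms(1-4) by (simp add: diff_telescope)
  finally show ?thesis .
qed

lemma (in abelian_group) minus_add_cancel:
  assumes "a \<in> carrier G" "b \<in> carrier G"
  shows "(a \<ominus> b) \<oplus> b = a"
  using assms by (simp add: a_minus_def a_assoc l_neg)

lemma (in abelian_group) diff_diff_cancel_right:
  assumes "a \<in> carrier G" "b \<in> carrier G" "c \<in> carrier G"
  shows "(a \<ominus> c) \<ominus> (b \<ominus> c) = a \<ominus> b"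
proof -
  have "(a \<ominus> c) \<ominus> (b \<ominus> c) = (a \<ominus> c) \<oplus> (c \<ominus> b)"
    using assms by (simp add: a_minus_def minus_add a_comm)
  then show ?thesis
    using assms by (simp add: diff_telescope)
qed

text \<open>Makes the pointwise difference of two additive maps additive, as required for
  \<open>act\<close>.\<close>

lemma (in abelian_group) add_diff_add:
  assumes "a \<in> carrier G" "b \<in> carrier G" "c \<in> carrier G" "d \<in> carrier G"
  shows "(a \<oplus> b) \<ominus> (c \<oplus> d) = (a \<ominus> c) \<oplus> (b \<ominus> d)"
  using assms by (simp add: a_minus_def minus_add a_ac)

context torsion_algebra
begin

lemma End_closed: "f \<in> module_End k C \<Longrightarrow> X \<in> carrier C \<Longrightarrow> f X \<in> carrier C"
  by (auto simp: module_End_def)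

lemma End_add:
  "f \<in> module_End k C \<Longrightarrow> X \<in> carrier C \<Longrightarrow> Y \<in> carrier C \<Longrightarrow> f (X \<oplus>\<^bsub>C\<^esub> Y) = f X \<oplus>\<^bsub>C\<^esub> f Y"
  by (auto simp: module_End_def)

lemma End_smult:
  "f \<in> module_End k C \<Longrightarrow> a \<in> carrier k \<Longrightarrow> X \<in> carrier C \<Longrightarrow> f (a \<odot>\<^bsub>C\<^esub> X) = a \<odot>\<^bsub>C\<^esub> f X"
  by (auto simp: module_End_def)

text \<open>Stated for any map that is closed and additive on the carrier, so that it covers both
  endomorphisms and \<open>\<lambda>W. D W Z\<close>, which need not be extensional.\<close>

lemma additive_diff:
  assumes f: "\<And>X. X \<in> carrier C \<Longrightarrow> f X \<in> carrier C"
    and add: "\<And>X Y. X \<in> carrier C \<Longrightarrow> Y \<in> carrier C \<Longrightarrow> f (X \<oplus>\<^bsub>C\<^esub> Y) = f X \<oplus>\<^bsub>C\<^esub> f Y"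
    and X: "X \<in> carrier C" "Y \<in> carrier C"
  shows "f (X \<ominus>\<^bsub>C\<^esub> Y) = f X \<ominus>\<^bsub>C\<^esub> f Y"
proof -
  have "f X = f (X \<ominus>\<^bsub>C\<^esub> Y) \<oplus>\<^bsub>C\<^esub> f Y"
    using add[of "X \<ominus>\<^bsub>C\<^esub> Y" Y] X by (simp add: M.minus_add_cancel)
  then show ?thesis
    using f X by (simp add: a_minus_def M.a_assoc M.r_neg)
qed

lemma End_diff:
  assumes "f \<in> module_End k C" "X \<in> carrier C" "Y \<in> carrier C"
  shows "f (X \<ominus>\<^bsub>C\<^esub> Y) = f X \<ominus>\<^bsub>C\<^esub> f Y"
  using assms by (intro additive_diff) (auto simp: End_closed End_add)

lemma D_closed: "X \<in> carrier C \<Longrightarrow> Y \<in> carrier C \<Longrightarrow> D X Y \<in> carrier C"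
  by (simp add: D_End End_closed)

lemma D_diff_left:
  assumes "X \<in> carrier C" "Y \<in> carrier C" "Z \<in> carrier C"
  shows "D (X \<ominus>\<^bsub>C\<^esub> Y) Z = D X Z \<ominus>\<^bsub>C\<^esub> D Y Z"
  using additive_diff[of "\<lambda>W. D W Z" X Y] assms by (simp add: D_closed D_add_left)

lemma mfunction_End: "\<phi> \<in> mfunctions k C D \<Longrightarrow> \<phi> \<in> module_End k C"
  by (simp add: mfunctions_def)

lemma mfunction_D:
  "\<phi> \<in> mfunctions k C D \<Longrightarrow> X \<in> carrier C \<Longrightarrow> Y \<in> carrier C \<Longrightarrow> D (\<phi> X) Y = \<phi> (D X Y)"
  by (simp add: mfunctions_def)

lemma act_apply: "Y \<in> carrier C \<Longrightarrow> act C D X \<phi> Y = D X (\<phi> Y) \<ominus>\<^bsub>C\<^esub> \<phi> (D X Y)"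
  by (simp add: act_def End_minus_def End_comp_def compose_eq)

text \<open>A commutator of two endomorphisms is an endomorphism; extensionality comes from the
  restricted lambda in \<open>End_minus\<close>.\<close>

lemma act_End:
  assumes X: "X \<in> carrier C" and \<phi>: "\<phi> \<in> module_End k C"
  shows "act C D X \<phi> \<in> module_End k C"
proof -
  note [simp] = act_apply End_closed[OF \<phi>] End_add[OF \<phi>] End_smult[OF \<phi>]
    End_closed[OF D_End[OF X]] End_add[OF D_End[OF X]] End_smult[OF D_End[OF X]]
  have "act C D X \<phi> \<in> extensional (carrier C)"
    by (simp add: act_def End_minus_def)
  then have "act C D X \<phi> \<in> carrier C \<rightarrow>\<^sub>E carrier C"
    by (auto simp: PiE_def)
  moreover have "act C D X \<phi> (a \<odot>\<^bsub>C\<^esub> Y) = a \<odot>\<^bsub>C\<^esub> act C D X \<phi> Y"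
    if "a \<in> carrier k" "Y \<in> carrier C" for a Y
    using that by (simp add: a_minus_def smult_r_distr smult_r_minus)
  ultimately show ?thesis
    by (simp add: module_End_def M.add_diff_add)
qed

lemma connection:
  assumes "X \<in> carrier C" "Y \<in> carrier C" "\<phi> \<in> module_End k C"
  shows "D X (\<phi> Y) = act C D X \<phi> Y \<oplus>\<^bsub>C\<^esub> \<phi> (D X Y)"
  using assms by (simp add: act_apply M.minus_add_cancel D_closed End_closed)

text \<open>The usual commutator identity: on the right, \<open>\<phi> (D X (\<psi> Z))\<close>
  occurs once with each sign, and the sum telescopes.\<close>

lemma act_comp:
  assumes X: "X \<in> carrier C" and \<phi>: "\<phi> \<in> module_End k C" and \<psi>: "\<psi> \<in> module_End k C"
  shows "act C D X (End_comp C \<phi> \<psi>)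
    = End_plus C (End_comp C (act C D X \<phi>) \<psi>) (End_comp C \<phi> (act C D X \<psi>))"
proof (rule ext)
  fix Z
  show "act C D X (End_comp C \<phi> \<psi>) Z
    = End_plus C (End_comp C (act C D X \<phi>) \<psi>) (End_comp C \<phi> (act C D X \<psi>)) Z"
  proof (cases "Z \<in> carrier C")
    case True
    then show ?thesis
      using X \<phi> \<psi>
      by (simp add: act_apply End_plus_def End_comp_def compose_eq End_closed D_closed End_diff
          M.diff_telescope)
  next
    \<comment> \<open>Off the carrier both sides are restricted functions, hence
      \<open>undefined\<close>.\<close>
    case False
    then show ?thesis
      by (simp add: act_def End_minus_def End_plus_def)
  qed
qed

end

context regular_torsion_algebra
begin

lemma act_mfunction:
  assumes X: "X \<in> carrier C" and \<phi>: "\<phi> \<in> mfunctions k C D"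
  shows "act C D X \<phi> \<in> mfunctions k C D"
proof -
  note \<phi>E = mfunction_End[OF \<phi>]
  have "D (act C D X \<phi> Y) Z = act C D X \<phi> (D Y Z)" if YZ: "Y \<in> carrier C" "Z \<in> carrier C" for Y Z
  proof -
    note [simp] = X YZ D_closed End_closed[OF \<phi>E] mfunction_D[OF \<phi>]
    have "associator C D X (\<phi> Y) Z = \<phi> (associator C D X Y Z)"
      using associator_linear \<phi> by (simp add: linear_over_first_two_def)
    then have "D (D X (\<phi> Y)) Z \<ominus>\<^bsub>C\<^esub> D X (\<phi> (D Y Z))
        = \<phi> (D (D X Y) Z) \<ominus>\<^bsub>C\<^esub> \<phi> (D X (D Y Z))"
      by (simp add: associator_def End_diff[OF \<phi>E])
    \<comment> \<open>The rotation puts the equation first among the premises, where the chained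
      fact meets it. After the swap, \<open>\<phi> (D (D X Y) Z)\<close> equals
      \<open>D (\<phi> (D X Y)) Z\<close>, so the left side collects into
      \<open>D (act C D X \<phi> Y) Z\<close>; the right side is \<open>act C D X \<phi>\<close> at
      \<open>D Y Z\<close>.\<close>
    then have "D (D X (\<phi> Y)) Z \<ominus>\<^bsub>C\<^esub> \<phi> (D (D X Y) Z)
        = D X (\<phi> (D Y Z)) \<ominus>\<^bsub>C\<^esub> \<phi> (D X (D Y Z))"
      by (rule M.diff_diff_swap[rotated 4]) simp_all
    then show ?thesis
      by (simp add: act_apply D_diff_left)
  qed
  then show ?thesis
    using act_End[OF X \<phi>E] by (simp add: mfunctions_def)
qed

lemma lie_mfunction:
  assumes X: "X \<in> carrier C" and Y: "Y \<in> carrier C" and \<phi>: "\<phi> \<in> mfunctions k C D"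
  shows "lie X (\<phi> Y) = \<phi> (lie X Y) \<oplus>\<^bsub>C\<^esub> act C D X \<phi> Y"
proof -
  note \<phi>E = mfunction_End[OF \<phi>]
  note [simp] = X Y D_closed lie_closed End_closed[OF \<phi>E] mfunction_D[OF \<phi>]
  have "torsion C D lie X (\<phi> Y) = \<phi> (torsion C D lie X Y)"
    using torsion_bilinear \<phi> by (simp add: bilinear_over_def)
  then have "D X (\<phi> Y) \<ominus>\<^bsub>C\<^esub> \<phi> (D Y X) \<ominus>\<^bsub>C\<^esub> lie X (\<phi> Y)
      = \<phi> (D X Y) \<ominus>\<^bsub>C\<^esub> \<phi> (D Y X) \<ominus>\<^bsub>C\<^esub> \<phi> (lie X Y)"
    by (simp add: torsion_def End_diff[OF \<phi>E])
  \<comment> \<open>The two \<open>D\<close> parts, each still containing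
    \<open>\<phi> (D Y X)\<close>, go to one side and the two brackets to the other.\<close>
  then have "(D X (\<phi> Y) \<ominus>\<^bsub>C\<^esub> \<phi> (D Y X)) \<ominus>\<^bsub>C\<^esub> (\<phi> (D X Y) \<ominus>\<^bsub>C\<^esub> \<phi> (D Y X))
      = lie X (\<phi> Y) \<ominus>\<^bsub>C\<^esub> \<phi> (lie X Y)"
    by (rule M.diff_diff_swap[rotated 4]) simp_all
  moreover have "(D X (\<phi> Y) \<ominus>\<^bsub>C\<^esub> \<phi> (D Y X)) \<ominus>\<^bsub>C\<^esub> (\<phi> (D X Y) \<ominus>\<^bsub>C\<^esub> \<phi> (D Y X)) = act C D X \<phi> Y"
    by (simp add: act_apply M.diff_diff_cancel_right)
  ultimately have "act C D X \<phi> Y = lie X (\<phi> Y) \<ominus>\<^bsub>C\<^esub> \<phi> (lie X Y)"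
    by simp
  then show ?thesis
    using M.minus_add_cancel[of "lie X (\<phi> Y)" "\<phi> (lie X Y)"] by (simp add: M.a_comm)
qed

end

theorem theorem3p1:
  fixes k :: "('k, 'm) ring_scheme" and C :: "('k, 'c, 'n) module_scheme"
    and D lie :: "'c \<Rightarrow> 'c \<Rightarrow> 'c"
    and X Y :: 'c and \<phi> :: "'c \<Rightarrow> 'c"
  assumes "regular_torsion_algebra k C D lie"
    and "X \<in> carrier C" and "Y \<in> carrier C"
    and "\<phi> \<in> mfunctions k C D"
  shows "act C D X \<phi> \<in> mfunctions k C D
    \<and> (\<forall>\<psi>\<in>mfunctions k C D.
         act C D X (End_comp C \<phi> \<psi>)
           = End_plus C (End_comp C (act C D X \<phi>) \<psi>) (End_comp C \<phi> (act C D X \<psi>)))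
    \<and> linear_over_first_two (mfunctions k C D) C (associator C D)
    \<and> lie X (\<phi> Y) = \<phi> (lie X Y) \<oplus>\<^bsub>C\<^esub> act C D X \<phi> Y
    \<and> D X (\<phi> Y) = act C D X \<phi> Y \<oplus>\<^bsub>C\<^esub> \<phi> (D X Y)
    \<and> bilinear_over (mfunctions k C D) C (torsion C D lie)"
proof -
  interpret regular_torsion_algebra k C D lie by fact
  show ?thesis
    using assms(2-) associator_linear torsion_bilinear
    by (simp add: act_mfunction act_comp lie_mfunction connection mfunction_End)
qed

end
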